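(* The partial order $(\mathbf{Peq},\leq)$ of punctual degrees is not rigid, i.e. it has a non-trivial automorphism.
   Context: A punctual equivalence relation is a primitive recursive equivalence relation with domain $\omega$ having infinitely many equivalence classes. For equivalence relations $R,S$ on $\omega$, $R\leq_{pr} S$ means that there is a primitive recursive function $f:\omega\to\omega$ such that for all $x,y\in\omega$, $x\mathrel{R}y \Leftrightarrow f(x)\mathrel{S}f(y)$. Write $R\equiv_{pr}S$ if $R\leq_{pr}S$ and $S\leq_{pr}R$. $(\mathbf{Peq},\leq)$ is the partial order of $\equiv_{pr}$-classes of punctual equivalence relations, ordered by the order induced by $\leq_{pr}$. *)

theory Defs
  imports Main
begin

section \<open>Primitive recursive functions\<close>

text \<open>
  \<open>primitive_rec n F\<close>: the function that \<open>F\<close> computes on argument lists of length \<open>n\<close> is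
  generated as an \<open>n\<close>-ary primitive recursive function. The values of \<open>F\<close> on lists of any other
  length carry no meaning. Recursion is on the first argument.
\<close>

inductive primitive_rec :: "nat \<Rightarrow> (nat list \<Rightarrow> nat) \<Rightarrow> bool" where
  zero: "primitive_rec n (\<lambda>xs. 0)"
| succ: "primitive_rec 1 (\<lambda>xs. Suc (hd xs))"
| proj: "i < n \<Longrightarrow> primitive_rec n (\<lambda>xs. xs ! i)"
| comp: "primitive_rec (length Gs) F \<Longrightarrow> (\<And>G. G \<in> set Gs \<Longrightarrow> primitive_rec n G) \<Longrightarrow>
    primitive_rec n (\<lambda>xs. F (map (\<lambda>G. G xs) Gs))"
| prec: "primitive_rec n F \<Longrightarrow> primitive_rec (Suc (Suc n)) G \<Longrightarrow>
    primitive_rec (Suc n)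
      (\<lambda>xs. rec_nat (F (tl xs)) (\<lambda>k r. G (k # r # tl xs)) (hd xs))"

definition primitive_rec_fun :: "(nat \<Rightarrow> nat) \<Rightarrow> bool" where
  "primitive_rec_fun f \<longleftrightarrow> (\<exists>F. primitive_rec 1 F \<and> (\<forall>x. F [x] = f x))"

text \<open>A binary relation is primitive recursive if its characteristic function is.\<close>

definition primitive_rec_rel :: "nat rel \<Rightarrow> bool" where
  "primitive_rec_rel R \<longleftrightarrow>
    (\<exists>F. primitive_rec 2 F \<and> (\<forall>x y. F [x, y] = (if (x, y) \<in> R then 1 else 0)))"


section \<open>Punctual equivalence relations and their degrees\<close>

definition punctual_equiv :: "nat rel \<Rightarrow> bool" where
  "punctual_equiv R \<longleftrightarrow> equiv UNIV R \<and> primitive_rec_rel R \<and> infinite (UNIV // R)"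

definition pr_reducible :: "nat rel \<Rightarrow> nat rel \<Rightarrow> bool" (infix \<open>\<le>\<^sub>p\<^sub>r\<close> 50) where
  "R \<le>\<^sub>p\<^sub>r S \<longleftrightarrow>
    (\<exists>f. primitive_rec_fun f \<and> (\<forall>x y. (x, y) \<in> R \<longleftrightarrow> (f x, f y) \<in> S))"

definition pr_equivalent :: "nat rel \<Rightarrow> nat rel \<Rightarrow> bool" (infix \<open>\<equiv>\<^sub>p\<^sub>r\<close> 50) where
  "R \<equiv>\<^sub>p\<^sub>r S \<longleftrightarrow> R \<le>\<^sub>p\<^sub>r S \<and> S \<le>\<^sub>p\<^sub>r R"

definition punctual_equivalence :: "nat rel rel" where
  "punctual_equivalence = {(R, S). punctual_equiv R \<and> punctual_equiv S \<and> R \<equiv>\<^sub>p\<^sub>r S}"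

definition Peq :: "nat rel set set" where
  "Peq = Collect punctual_equiv // punctual_equivalence"

definition Peq_order :: "nat rel set rel" where
  "Peq_order = {(a, b). a \<in> Peq \<and> b \<in> Peq \<and> (\<exists>R\<in>a. \<exists>S\<in>b. R \<le>\<^sub>p\<^sub>r S)}"


section \<open>Automorphisms of partial orders\<close>

definition order_automorphism :: "'a set \<Rightarrow> 'a rel \<Rightarrow> ('a \<Rightarrow> 'a) \<Rightarrow> bool" where
  "order_automorphism A r \<phi> \<longleftrightarrow>
    bij_betw \<phi> A A \<and> (\<forall>a\<in>A. \<forall>b\<in>A. (a, b) \<in> r \<longleftrightarrow> (\<phi> a, \<phi> b) \<in> r)"

definition rigid_order :: "'a set \<Rightarrow> 'a rel \<Rightarrow> bool" where
  "rigid_order A r \<longleftrightarrow> (\<forall>\<phi>. order_automorphism A r \<phi> \<longrightarrow> (\<forall>a\<in>A. \<phi> a = a))"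


section \<open>The punctual degrees form a partial order\<close>

lemma primitive_rec_fun_id: "primitive_rec_fun (\<lambda>x. x)"
  unfolding primitive_rec_fun_def
  by (rule exI[of _ "\<lambda>xs. xs ! 0"]) (auto intro: primitive_rec.proj)

lemma primitive_rec_fun_comp:
  assumes "primitive_rec_fun f" "primitive_rec_fun g"
  shows "primitive_rec_fun (\<lambda>x. f (g x))"
proof -
  obtain F G where F: "primitive_rec 1 F" "\<And>x. F [x] = f x"
    and G: "primitive_rec 1 G" "\<And>x. G [x] = g x"
    using assms unfolding primitive_rec_fun_def by blast
  have "primitive_rec 1 (\<lambda>xs. F (map (\<lambda>G. G xs) [G]))"
    by (rule primitive_rec.comp) (use F G in auto)
  then show ?thesis
    unfolding primitive_rec_fun_def using F G by auto
qed

lemma pr_reducible_refl: "R \<le>\<^sub>p\<^sub>r R"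
  unfolding pr_reducible_def using primitive_rec_fun_id by blast

lemma pr_reducible_trans:
  assumes "R \<le>\<^sub>p\<^sub>r S" "S \<le>\<^sub>p\<^sub>r T"
  shows "R \<le>\<^sub>p\<^sub>r T"
proof -
  obtain f where f: "primitive_rec_fun f" "\<forall>x y. (x, y) \<in> R \<longleftrightarrow> (f x, f y) \<in> S"
    using assms(1) unfolding pr_reducible_def by blast
  obtain g where g: "primitive_rec_fun g" "\<forall>x y. (x, y) \<in> S \<longleftrightarrow> (g x, g y) \<in> T"
    using assms(2) unfolding pr_reducible_def by blast
  have "\<forall>x y. (x, y) \<in> R \<longleftrightarrow> (g (f x), g (f y)) \<in> T"
    using f(2) g(2) by simp
  then show ?thesis
    unfolding pr_reducible_def using primitive_rec_fun_comp[OF g(1) f(1)] by blast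
qed

lemma equiv_punctual_equivalence: "equiv (Collect punctual_equiv) punctual_equivalence"
proof (rule equivI)
  show "punctual_equivalence \<subseteq> Collect punctual_equiv \<times> Collect punctual_equiv"
    by (auto simp: punctual_equivalence_def)
  show "refl_on (Collect punctual_equiv) punctual_equivalence"
    by (auto simp: refl_on_def punctual_equivalence_def pr_equivalent_def pr_reducible_refl)
  show "sym punctual_equivalence"
    by (auto simp: sym_def punctual_equivalence_def pr_equivalent_def)
  show "trans punctual_equivalence"
    unfolding trans_def punctual_equivalence_def pr_equivalent_def
    using pr_reducible_trans by blast
qed

lemma Peq_order_class_iff:
  assumes "punctual_equiv R" "punctual_equiv S"
  shows "(punctual_equivalence `` {R}, punctual_equivalence `` {S}) \<in> Peq_order \<longleftrightarrow> R \<le>\<^sub>p\<^sub>r S"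
proof -
  have "punctual_equivalence `` {R} \<in> Peq" "punctual_equivalence `` {S} \<in> Peq"
    using assms by (auto simp: Peq_def intro: quotientI)
  moreover have "(\<exists>R'\<in>punctual_equivalence `` {R}. \<exists>S'\<in>punctual_equivalence `` {S}. R' \<le>\<^sub>p\<^sub>r S')
      \<longleftrightarrow> R \<le>\<^sub>p\<^sub>r S" (is "?L \<longleftrightarrow> _")
  proof
    assume ?L
    then obtain R' S' where "R \<le>\<^sub>p\<^sub>r R'" "R' \<le>\<^sub>p\<^sub>r S'" "S' \<le>\<^sub>p\<^sub>r S"
      by (auto simp: punctual_equivalence_def pr_equivalent_def)
    then show "R \<le>\<^sub>p\<^sub>r S"
      using pr_reducible_trans by blast
  next
    assume "R \<le>\<^sub>p\<^sub>r S"
    then show ?L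
      using equiv_class_self[OF equiv_punctual_equivalence] assms by blast
  qed
  ultimately show ?thesis
    by (simp add: Peq_order_def)
qed

lemma partial_order_on_Peq: "partial_order_on Peq Peq_order"
proof -
  have cls: "\<exists>R. punctual_equiv R \<and> a = punctual_equivalence `` {R}" if "a \<in> Peq" for a
    using that by (auto simp: Peq_def elim: quotientE)
  have sub: "Peq_order \<subseteq> Peq \<times> Peq"
    by (auto simp: Peq_order_def)
  have "refl_on Peq Peq_order"
  proof (rule refl_onI)
    fix a
    assume "a \<in> Peq"
    then obtain R where "punctual_equiv R" "a = punctual_equivalence `` {R}"
      using cls by blast
    then show "(a, a) \<in> Peq_order"
      by (simp add: Peq_order_class_iff pr_reducible_refl)
  qed
  moreover have "trans Peq_order"
  proof (rule transI)
    fix a b c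
    assume *: "(a, b) \<in> Peq_order" "(b, c) \<in> Peq_order"
    then have mem: "a \<in> Peq" "b \<in> Peq" "c \<in> Peq"
      using sub by auto
    obtain R where R: "punctual_equiv R" "a = punctual_equivalence `` {R}"
      using cls[OF mem(1)] by auto
    obtain S where S: "punctual_equiv S" "b = punctual_equivalence `` {S}"
      using cls[OF mem(2)] by auto
    obtain T where T: "punctual_equiv T" "c = punctual_equivalence `` {T}"
      using cls[OF mem(3)] by auto
    have "R \<le>\<^sub>p\<^sub>r S" "S \<le>\<^sub>p\<^sub>r T"
      using * R S T by (simp_all add: Peq_order_class_iff)
    then have "R \<le>\<^sub>p\<^sub>r T"
      by (rule pr_reducible_trans)
    then show "(a, c) \<in> Peq_order"
      using R T by (simp add: Peq_order_class_iff)
  qed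
  moreover have "antisym Peq_order"
  proof (rule antisymI)
    fix a b
    assume *: "(a, b) \<in> Peq_order" "(b, a) \<in> Peq_order"
    then have mem: "a \<in> Peq" "b \<in> Peq"
      using sub by auto
    obtain R where R: "punctual_equiv R" "a = punctual_equivalence `` {R}"
      using cls[OF mem(1)] by auto
    obtain S where S: "punctual_equiv S" "b = punctual_equivalence `` {S}"
      using cls[OF mem(2)] by auto
    have "R \<le>\<^sub>p\<^sub>r S" "S \<le>\<^sub>p\<^sub>r R"
      using * R S by (simp_all add: Peq_order_class_iff)
    then have "(R, S) \<in> punctual_equivalence"
      using R(1) S(1) by (simp add: punctual_equivalence_def pr_equivalent_def)
    then show "a = b"
      unfolding R(2) S(2) by (rule equiv_class_eq[OF equiv_punctual_equivalence])
  qed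
  ultimately show ?thesis
    using sub by (simp add: partial_order_on_def preorder_on_def)
qed

end

theory Submission
  imports Defs
begin

text \<open>
  The automorphism is \<open>R \<mapsto> 1 + R\<close>: adjoin to \<open>R\<close> one new class, placed in front of all the
  others (\<open>adjoin_class\<close>). A reduction \<open>R \<le> S\<close> extends to \<open>1 + R \<le> 1 + S\<close>. Conversely, a reduction
  of \<open>1 + R\<close> to \<open>1 + S\<close> may send an old class to the new class of \<open>S\<close>; but then the image of
  the new class of \<open>R\<close> is a free old class of \<open>S\<close> and can take its place, which gives \<open>R \<le> S\<close>.
  Finally every \<open>S\<close> is equivalent to some \<open>1 + R\<close>: merge the class of \<open>0\<close> in \<open>S\<close> with another
  class to obtain \<open>R\<close>. Hence \<open>R \<mapsto> 1 + R\<close> induces an order automorphism of the degrees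
  (\<open>order_automorphism_adjoin_class_degree\<close>).

  It moves some degree. If \<open>p\<^sub>k\<close> denotes the least element of the \<open>k\<close>-th class of \<open>R\<close> in order
  of appearance, counted from \<open>0\<close>, then a reduction \<open>f\<close> of \<open>1 + R\<close> to \<open>R\<close> has to map the \<open>k + 2\<close> classes that meet
  \<open>{0..p\<^sub>k + 1}\<close> to different classes, so it takes there a value at least \<open>p\<^sub>k\<^sub>+\<^sub>1\<close>. It thus
  suffices to find a punctual \<open>R\<close> such that for every primitive recursive \<open>f\<close> there is a \<open>k\<close>
  with \<open>f x < p\<^sub>k\<^sub>+\<^sub>1\<close> for all \<open>x \<le> p\<^sub>k + 1\<close>.
  The gaps come from a fast-growing hierarchy \<open>F\<^sub>a\<close> of Ackermann type: each primitive recursive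
  function is bounded by one of its levels (\<open>primitive_rec_hierarchy_bounded\<close>). The function
  \<open>n \<mapsto> F\<^sub>n (n + 1)\<close> is therefore not primitive recursive, but it is the time at which a certain
  machine halts when it is started at time \<open>n + 1\<close> with input \<open>n\<close> (\<open>stack_run\<close>). A state of the
  machine is a stack of numbers, which is encoded by a number in such a way that single steps, and
  with them the sequence of all states, are primitive recursive (\<open>pr_encode_stack\<close>). Whenever
  the stack is empty, the machine restarts with the current time as input, and the times of the
  empty stack are the numbers \<open>p\<^sub>k\<close> of the required \<open>R\<close> (\<open>sparse_rel\<close>).
\<close>


section \<open>A calculus for primitive recursive terms\<close>

text \<open>
  As values on lists of the wrong length carry no meaning, closure properties are stated up to
  agreement on lists of length \<open>n\<close>. The variables of a term \<open>f\<close> are \<open>xs ! 0, \<dots>, xs ! (n - 1)\<close>,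
  so that primitive recursiveness of a term is shown by following its syntax.
\<close>

definition pr :: "nat \<Rightarrow> (nat list \<Rightarrow> nat) \<Rightarrow> bool" where
  "pr n f \<longleftrightarrow> (\<exists>F. primitive_rec n F \<and> (\<forall>xs. length xs = n \<longrightarrow> F xs = f xs))"

lemma pr_cong:
  assumes "pr n f" "\<And>xs. length xs = n \<Longrightarrow> f xs = g xs"
  shows "pr n g"
  using assms unfolding pr_def by auto

lemma pr_compose:
  assumes F: "pr (length Gs) F" and Gs: "\<And>G. G \<in> set Gs \<Longrightarrow> pr n G"
  shows "pr n (\<lambda>xs. F (map (\<lambda>G. G xs) Gs))"
proof -
  obtain F' where F': "primitive_rec (length Gs) F'" "\<And>xs. length xs = length Gs \<Longrightarrow> F' xs = F xs"
    using F unfolding pr_def by auto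
  obtain H where H: "\<And>G. G \<in> set Gs \<Longrightarrow> primitive_rec n (H G)"
      "\<And>G xs. G \<in> set Gs \<Longrightarrow> length xs = n \<Longrightarrow> H G xs = G xs"
    using Gs unfolding pr_def by metis
  have "primitive_rec n (\<lambda>xs. F' (map (\<lambda>G. G xs) (map H Gs)))"
    by (rule primitive_rec.comp) (use F' H in auto)
  moreover have "F' (map (\<lambda>G. G xs) (map H Gs)) = F (map (\<lambda>G. G xs) Gs)" if "length xs = n" for xs
  proof -
    have "map (\<lambda>G. G xs) (map H Gs) = map (\<lambda>G. G xs) Gs"
      using H that by auto
    then show ?thesis
      using F'(2) by (metis length_map)
  qed
  ultimately show ?thesis
    unfolding pr_def by blast
qed

lemma pr_compose1:
  assumes "pr 1 (\<lambda>xs. h (xs ! 0))" "pr n f"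
  shows "pr n (\<lambda>xs. h (f xs))"
  using pr_compose[of "[f]" "\<lambda>xs. h (xs ! 0)" n] assms by simp

lemma pr_compose2:
  assumes "pr 2 (\<lambda>xs. h (xs ! 0) (xs ! 1))" "pr n f" "pr n g"
  shows "pr n (\<lambda>xs. h (f xs) (g xs))"
  using pr_compose[of "[f, g]" "\<lambda>xs. h (xs ! 0) (xs ! 1)" n] assms
  by (auto simp: numeral_2_eq_2)

lemma pr_compose3:
  assumes "pr 3 (\<lambda>xs. h (xs ! 0) (xs ! 1) (xs ! 2))" "pr n f" "pr n g" "pr n k"
  shows "pr n (\<lambda>xs. h (f xs) (g xs) (k xs))"
  using pr_compose[of "[f, g, k]" "\<lambda>xs. h (xs ! 0) (xs ! 1) (xs ! 2)" n] assms
  by (auto simp: numeral_3_eq_3)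

lemma pr_nth: "i < n \<Longrightarrow> pr n (\<lambda>xs. xs ! i)"
  unfolding pr_def using primitive_rec.proj by blast

lemma pr_Suc:
  assumes "pr n f"
  shows "pr n (\<lambda>xs. Suc (f xs))"
proof (rule pr_compose1[OF _ assms])
  have "F xs = Suc (xs ! 0)" if "F = (\<lambda>xs. Suc (hd xs))" "length xs = 1" for F xs
    using that by (cases xs) auto
  then show "pr 1 (\<lambda>xs. Suc (xs ! 0))"
    unfolding pr_def using primitive_rec.succ by blast
qed

lemma pr_const: "pr n (\<lambda>xs. c)"
proof (induction c)
  case 0
  show ?case
    unfolding pr_def using primitive_rec.zero by blast
next
  case (Suc c)
  then show ?case
    by (rule pr_Suc)
qed

text \<open>
  The recursion scheme transferred to \<open>pr\<close>. The rules \<open>pr_rec1\<close>, \<open>pr_rec2\<close> and \<open>pr_rec3\<close> below are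
  its instances with no, one and two parameters, the recursion running up to the value of a term.
\<close>

lemma pr_prec:
  assumes "pr n a" "pr (Suc (Suc n)) g"
  shows "pr (Suc n) (\<lambda>xs. rec_nat (a (tl xs)) (\<lambda>k r. g (k # r # tl xs)) (hd xs))"
proof -
  obtain A where A: "primitive_rec n A" "\<And>xs. length xs = n \<Longrightarrow> A xs = a xs"
    using assms(1) unfolding pr_def by auto
  obtain G where G: "primitive_rec (Suc (Suc n)) G" "\<And>xs. length xs = Suc (Suc n) \<Longrightarrow> G xs = g xs"
    using assms(2) unfolding pr_def by auto
  show ?thesis
    unfolding pr_def
  proof (intro exI conjI allI impI)
    show "primitive_rec (Suc n) (\<lambda>xs. rec_nat (A (tl xs)) (\<lambda>k r. G (k # r # tl xs)) (hd xs))"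
      by (rule primitive_rec.prec[OF A(1) G(1)])
  qed (simp add: A G)
qed

lemma length_2_conv: "length xs = 2 \<longleftrightarrow> (\<exists>x y. xs = [x, y])"
  by (auto simp: numeral_2_eq_2 length_Suc_conv)

lemma length_3_conv: "length xs = 3 \<longleftrightarrow> (\<exists>x y z. xs = [x, y, z])"
  by (auto simp: numeral_3_eq_3 length_Suc_conv)

lemma pr_rec1:
  assumes "pr 2 (\<lambda>xs. g (xs ! 0) (xs ! 1))" "pr n f"
  shows "pr n (\<lambda>xs. rec_nat c g (f xs))"
proof (rule pr_compose1[OF _ assms(2)])
  have "pr (Suc 0) (\<lambda>xs. rec_nat c (\<lambda>k r. g ((k # r # tl xs) ! 0) ((k # r # tl xs) ! 1)) (hd xs))"
    by (rule pr_prec[where a = "\<lambda>_. c" and g = "\<lambda>xs. g (xs ! 0) (xs ! 1)"])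
      (use assms in \<open>auto simp: numeral_2_eq_2 pr_const\<close>)
  then show "pr 1 (\<lambda>xs. rec_nat c g (xs ! 0))"
    unfolding One_nat_def by (rule pr_cong) (auto simp: length_Suc_conv)
qed

lemma pr_rec2:
  assumes "pr 1 (\<lambda>xs. a (xs ! 0))" "pr 3 (\<lambda>xs. g (xs ! 0) (xs ! 1) (xs ! 2))"
    and "pr n f" "pr n p"
  shows "pr n (\<lambda>xs. rec_nat (a (p xs)) (\<lambda>k r. g k r (p xs)) (f xs))"
proof (rule pr_compose2[OF _ assms(3,4)])
  have "pr (Suc 1) (\<lambda>xs. rec_nat (a (tl xs ! 0))
      (\<lambda>k r. g ((k # r # tl xs) ! 0) ((k # r # tl xs) ! 1) ((k # r # tl xs) ! 2)) (hd xs))"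
    by (rule pr_prec[where g = "\<lambda>xs. g (xs ! 0) (xs ! 1) (xs ! 2)"])
      (use assms in \<open>auto simp: numeral_3_eq_3\<close>)
  then show "pr 2 (\<lambda>xs. rec_nat (a (xs ! 1)) (\<lambda>k r. g k r (xs ! 1)) (xs ! 0))"
    unfolding Suc_1 by (rule pr_cong) (auto simp: length_2_conv)
qed

lemma pr_rec3:
  assumes "pr 2 (\<lambda>xs. a (xs ! 0) (xs ! 1))"
    and "pr 4 (\<lambda>xs. g (xs ! 0) (xs ! 1) (xs ! 2) (xs ! 3))"
    and "pr n f" "pr n p" "pr n q"
  shows "pr n (\<lambda>xs. rec_nat (a (p xs) (q xs)) (\<lambda>k r. g k r (p xs) (q xs)) (f xs))"
proof (rule pr_compose3[OF _ assms(3-5)])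
  have "pr (Suc 2) (\<lambda>xs. rec_nat (a (tl xs ! 0) (tl xs ! 1))
      (\<lambda>k r. g ((k # r # tl xs) ! 0) ((k # r # tl xs) ! 1) ((k # r # tl xs) ! 2)
        ((k # r # tl xs) ! 3)) (hd xs))"
    by (rule pr_prec[where g = "\<lambda>xs. g (xs ! 0) (xs ! 1) (xs ! 2) (xs ! 3)"
          and a = "\<lambda>xs. a (xs ! 0) (xs ! 1)"]) (use assms in \<open>auto simp: eval_nat_numeral\<close>)
  then have "pr 3 (\<lambda>xs. rec_nat (a (tl xs ! 0) (tl xs ! 1))
      (\<lambda>k r. g ((k # r # tl xs) ! 0) ((k # r # tl xs) ! 1) ((k # r # tl xs) ! 2)
        ((k # r # tl xs) ! 3)) (hd xs))"
    by (simp add: eval_nat_numeral)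
  then show "pr 3 (\<lambda>xs. rec_nat (a (xs ! 1) (xs ! 2)) (\<lambda>k r. g k r (xs ! 1) (xs ! 2)) (xs ! 0))"
    by (rule pr_cong) (auto simp: length_3_conv)
qed

lemmas pr_basic = pr_nth pr_const pr_Suc

lemma pr_plus:
  assumes "pr n f" "pr n g"
  shows "pr n (\<lambda>xs. f xs + g xs)"
proof -
  have "rec_nat y (\<lambda>k r. Suc r) x = x + y" for x y
    by (induction x) auto
  moreover have "pr n (\<lambda>xs. rec_nat (g xs) (\<lambda>k r. Suc r) (f xs))"
    by (rule pr_rec2[where a = "\<lambda>y. y" and g = "\<lambda>k r p. Suc r"]) (use assms in \<open>auto intro!: pr_basic\<close>)
  ultimately show ?thesis
    by simp
qed

lemma pr_times:
  assumes "pr n f" "pr n g"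
  shows "pr n (\<lambda>xs. f xs * g xs)"
proof -
  have "rec_nat 0 (\<lambda>k r. r + y) x = x * y" for x y :: nat
    by (induction x) auto
  moreover have "pr n (\<lambda>xs. rec_nat 0 (\<lambda>k r. r + g xs) (f xs))"
    by (rule pr_rec2[where a = "\<lambda>y. 0" and g = "\<lambda>k r p. r + p"])
      (use assms in \<open>auto intro!: pr_basic pr_plus\<close>)
  ultimately show ?thesis
    by simp
qed

lemma pr_diff:
  assumes "pr n f" "pr n g"
  shows "pr n (\<lambda>xs. f xs - g xs)"
proof -
  have pred: "rec_nat 0 (\<lambda>k r. k) x = x - 1" for x :: nat
    by (cases x) auto
  have pr_pred: "pr m (\<lambda>xs. h xs - 1)" if "pr m h" for m h
    using pr_rec1[of "\<lambda>k r. k" m h 0] that unfolding pred by (simp add: pr_basic)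
  have "rec_nat y (\<lambda>k r. r - 1) x = y - x" for x y :: nat
    by (induction x) auto
  moreover have "pr n (\<lambda>xs. rec_nat (f xs) (\<lambda>k r. r - 1) (g xs))"
    by (rule pr_rec2[where a = "\<lambda>y. y" and g = "\<lambda>k r p. r - 1"])
      (use assms in \<open>auto intro!: pr_basic pr_pred simp del: One_nat_def\<close>)
  ultimately show ?thesis
    by simp
qed

lemma pr_if_zero:
  assumes "pr n c" "pr n f" "pr n g"
  shows "pr n (\<lambda>xs. if c xs = 0 then f xs else g xs)"
proof -
  \<comment> \<open>A recursion that forgets the previous value is a case distinction.\<close>
  have "rec_nat y (\<lambda>k r. z) x = (if x = 0 then y else z)" for x y z :: nat
    by (cases x) auto
  moreover have "pr n (\<lambda>xs. rec_nat (f xs) (\<lambda>k r. g xs) (c xs))"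
    by (rule pr_rec3[where a = "\<lambda>p q. p" and g = "\<lambda>k r p q. q"])
      (use assms in \<open>auto intro!: pr_basic\<close>)
  ultimately show ?thesis
    by simp
qed

lemma pr_if_eq:
  assumes "pr n c" "pr n d" "pr n f" "pr n g"
  shows "pr n (\<lambda>xs. if c xs = d xs then f xs else g xs)"
proof -
  have eq: "(c xs - d xs) + (d xs - c xs) = 0 \<longleftrightarrow> c xs = d xs" for xs
    by auto
  have "pr n (\<lambda>xs. if (c xs - d xs) + (d xs - c xs) = 0 then f xs else g xs)"
    by (intro pr_if_zero pr_plus pr_diff assms)
  then show ?thesis
    unfolding eq .
qed

lemma pr_mod:
  assumes "pr n f" "pr n g"
  shows "pr n (\<lambda>xs. f xs mod g xs)"
proof -
  have "rec_nat 0 (\<lambda>k r. if Suc r = y then 0 else Suc r) x = x mod y" for x y :: nat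
    by (induction x) (auto simp: mod_Suc)
  moreover have "pr n (\<lambda>xs. rec_nat 0 (\<lambda>k r. if Suc r = g xs then 0 else Suc r) (f xs))"
    by (rule pr_rec2[where a = "\<lambda>y. 0" and g = "\<lambda>k r p. if Suc r = p then 0 else Suc r"])
      (use assms in \<open>auto intro!: pr_basic pr_if_eq\<close>)
  ultimately show ?thesis
    by simp
qed

lemma pr_half:
  assumes "pr n f"
  shows "pr n (\<lambda>xs. f xs div 2)"
proof -
  have "rec_nat 0 (\<lambda>k r. r + k mod 2) x = x div 2" for x :: nat
    by (induction x) (auto, presburger)
  moreover have "pr n (\<lambda>xs. rec_nat 0 (\<lambda>k r. r + k mod 2) (f xs))"
    by (rule pr_rec1) (use assms in \<open>auto intro!: pr_basic pr_plus pr_mod\<close>)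
  ultimately show ?thesis
    by simp
qed

lemma pr_power2:
  assumes "pr n f"
  shows "pr n (\<lambda>xs. 2 ^ f xs)"
proof -
  have "rec_nat 1 (\<lambda>k r. 2 * r) x = (2 ^ x :: nat)" for x :: nat
    by (induction x) auto
  moreover have "pr n (\<lambda>xs. rec_nat 1 (\<lambda>k r. 2 * r) (f xs))"
    by (rule pr_rec1) (use assms in \<open>auto intro!: pr_basic pr_times\<close>)
  ultimately show ?thesis
    by (simp only:)
qed

lemmas pr_intros = pr_basic pr_plus pr_times pr_diff pr_if_eq pr_mod pr_half pr_power2

lemma primitive_rec_fun_iff_pr: "primitive_rec_fun f \<longleftrightarrow> pr 1 (\<lambda>xs. f (xs ! 0))"
proof -
  have "(\<forall>x. F [x] = f x) \<longleftrightarrow> (\<forall>xs. length xs = 1 \<longrightarrow> F xs = f (xs ! 0))" for F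
    by (auto simp: length_Suc_conv)
  then show ?thesis
    unfolding primitive_rec_fun_def pr_def by simp
qed

lemma pr_primitive_rec_fun:
  assumes "primitive_rec_fun f" "pr n h"
  shows "pr n (\<lambda>xs. f (h xs))"
  using assms pr_compose1 unfolding primitive_rec_fun_iff_pr by blast

lemma primitive_rec_rel_iff_pr:
  "primitive_rec_rel R \<longleftrightarrow> pr 2 (\<lambda>xs. if (xs ! 0, xs ! 1) \<in> R then 1 else 0)"
proof -
  have "(\<forall>x y. F [x, y] = (if (x, y) \<in> R then 1 else 0)) \<longleftrightarrow>
      (\<forall>xs. length xs = 2 \<longrightarrow> F xs = (if (xs ! 0, xs ! 1) \<in> R then 1 else 0))"
    for F :: "nat list \<Rightarrow> nat"
    by (auto simp: length_2_conv)
  then show ?thesis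
    unfolding primitive_rec_rel_def pr_def by (simp only:)
qed

lemma pr_if_rel:
  assumes R: "primitive_rec_rel R" and "pr n c" "pr n d" "pr n f" "pr n g"
  shows "pr n (\<lambda>xs. if (c xs, d xs) \<in> R then f xs else g xs)"
proof -
  have "pr n (\<lambda>xs. if (c xs, d xs) \<in> R then 1 else 0)"
    using pr_compose2[of "\<lambda>x y. if (x, y) \<in> R then 1 else 0"] assms
    unfolding primitive_rec_rel_iff_pr by simp
  then have "pr n (\<lambda>xs. if (if (c xs, d xs) \<in> R then 1 else 0) = (1::nat) then f xs else g xs)"
    by (intro pr_if_eq pr_const assms)
  then show ?thesis
    by (rule pr_cong) auto
qed


section \<open>Adjoining a class\<close>

lemma pr_reducibleI:
  assumes "primitive_rec_fun f" "\<And>x y. (x, y) \<in> R \<longleftrightarrow> (f x, f y) \<in> S"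
  shows "R \<le>\<^sub>p\<^sub>r S"
  using assms unfolding pr_reducible_def by blast

lemma equiv_UNIV_iff:
  "equiv UNIV R \<longleftrightarrow> (\<forall>x. (x, x) \<in> R) \<and> (\<forall>x y. (x, y) \<in> R \<longrightarrow> (y, x) \<in> R) \<and>
    (\<forall>x y z. (x, y) \<in> R \<longrightarrow> (y, z) \<in> R \<longrightarrow> (x, z) \<in> R)"
  by (auto simp: equiv_def refl_on_def sym_def trans_def)

lemma infinite_quotient_transfer:
  assumes R: "equiv UNIV R" and S: "equiv UNIV S"
    and f: "\<And>x y. (x, y) \<in> R \<longleftrightarrow> (f x, f y) \<in> S"
    and inf: "infinite (UNIV // R)"
  shows "infinite (UNIV // S)"
proof
  assume fin: "finite (UNIV // S)"
  have "UNIV // R \<subseteq> (\<lambda>C. f -` C) ` (UNIV // S)"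
  proof
    fix C
    assume "C \<in> UNIV // R"
    then obtain x where "C = R `` {x}"
      by (auto elim: quotientE)
    then have "C = f -` (S `` {f x})"
      using f by auto
    then show "C \<in> (\<lambda>C. f -` C) ` (UNIV // S)"
      by (auto intro: quotientI)
  qed
  then show False
    using fin inf finite_surj by blast
qed

definition adjoin_class :: "nat rel \<Rightarrow> nat rel" where
  "adjoin_class R = insert (0, 0) (map_prod Suc Suc ` R)"

lemma adjoin_class_simps [simp]:
  "(0, 0) \<in> adjoin_class R"
  "(0, Suc y) \<notin> adjoin_class R"
  "(Suc x, 0) \<notin> adjoin_class R"
  "(Suc x, Suc y) \<in> adjoin_class R \<longleftrightarrow> (x, y) \<in> R"
  by (auto simp: adjoin_class_def)

lemma adjoin_class_iff:
  "(x, y) \<in> adjoin_class R \<longleftrightarrow> (if x = 0 then y = 0 else y \<noteq> 0 \<and> (x - 1, y - 1) \<in> R)"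
  by (cases x; cases y) auto

lemma equiv_adjoin_class:
  assumes "equiv UNIV R"
  shows "equiv UNIV (adjoin_class R)"
  unfolding equiv_UNIV_iff
proof (intro conjI allI impI)
  have R: "(x, x) \<in> R" "(x, y) \<in> R \<Longrightarrow> (y, x) \<in> R"
      "(x, y) \<in> R \<Longrightarrow> (y, z) \<in> R \<Longrightarrow> (x, z) \<in> R" for x y z
    using assms unfolding equiv_UNIV_iff by blast+
  fix x y z
  show "(x, x) \<in> adjoin_class R"
    by (simp add: adjoin_class_iff R(1))
  show "(y, x) \<in> adjoin_class R" if "(x, y) \<in> adjoin_class R"
    using that R(2) by (auto simp: adjoin_class_iff split: if_splits)
  show "(x, z) \<in> adjoin_class R" if "(x, y) \<in> adjoin_class R" "(y, z) \<in> adjoin_class R"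
    using that R(3)[of "x - 1" "y - 1" "z - 1"] by (auto simp: adjoin_class_iff split: if_splits)
qed

lemma primitive_rec_rel_adjoin_class:
  assumes "primitive_rec_rel R"
  shows "primitive_rec_rel (adjoin_class R)"
proof -
  have "pr 2 (\<lambda>xs. if xs ! 0 = 0 then (if xs ! 1 = 0 then 1 else 0)
      else (if xs ! 1 = 0 then 0 else (if (xs ! 0 - 1, xs ! 1 - 1) \<in> R then 1 else 0)))"
    by (intro pr_intros pr_if_rel assms) auto
  then show ?thesis
    unfolding primitive_rec_rel_iff_pr by (rule pr_cong) (auto simp: adjoin_class_iff)
qed

lemma punctual_equiv_adjoin_class:
  assumes "punctual_equiv R"
  shows "punctual_equiv (adjoin_class R)"
  using assms infinite_quotient_transfer[of R "adjoin_class R" Suc]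
  unfolding punctual_equiv_def by (auto simp: equiv_adjoin_class primitive_rec_rel_adjoin_class)

lemma adjoin_class_mono:
  assumes "R \<le>\<^sub>p\<^sub>r S"
  shows "adjoin_class R \<le>\<^sub>p\<^sub>r adjoin_class S"
proof -
  obtain f where f: "primitive_rec_fun f" "\<And>x y. (x, y) \<in> R \<longleftrightarrow> (f x, f y) \<in> S"
    using assms unfolding pr_reducible_def by blast
  have "pr 1 (\<lambda>xs. if xs ! 0 = 0 then 0 else Suc (f (xs ! 0 - 1)))"
    by (intro pr_intros pr_primitive_rec_fun[OF f(1)]) auto
  then have "primitive_rec_fun (\<lambda>x. if x = 0 then 0 else Suc (f (x - 1)))"
    by (simp add: primitive_rec_fun_iff_pr)
  then show ?thesis
    by (rule pr_reducibleI) (simp add: adjoin_class_iff f(2))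
qed

text \<open>
  Cancellation by rerouting: if the reduction \<open>f\<close> sends \<open>Suc x\<close> to the new class \<open>{0}\<close>, then it
  sends \<open>0\<close> to an old class that is not hit by any \<open>Suc y\<close>, and the class of \<open>x\<close> can be sent there.
\<close>

lemma adjoin_class_cancel:
  assumes S: "equiv UNIV S" and le: "adjoin_class R \<le>\<^sub>p\<^sub>r adjoin_class S"
  shows "R \<le>\<^sub>p\<^sub>r S"
proof -
  obtain f where f: "primitive_rec_fun f"
      "\<And>x y. (x, y) \<in> adjoin_class R \<longleftrightarrow> (f x, f y) \<in> adjoin_class S"
    using le unfolding pr_reducible_def by blast
  define g where "g x = (if f (Suc x) = 0 then f 0 - 1 else f (Suc x) - 1)" for x
  \<comment> \<open>The subtractions undo the shift; where the first branch is taken, \<open>f 0\<close> is nonzero.\<close>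
  have "pr 1 (\<lambda>xs. if f (Suc (xs ! 0)) = 0 then f 0 - 1 else f (Suc (xs ! 0)) - 1)"
    by (intro pr_intros pr_primitive_rec_fun[OF f(1)]) auto
  then have "primitive_rec_fun g"
    by (simp add: primitive_rec_fun_iff_pr g_def)
  moreover have "(x, y) \<in> R \<longleftrightarrow> (g x, g y) \<in> S" for x y
  proof -
    have refl: "(z, z) \<in> S" for z
      using S by (simp add: equiv_UNIV_iff)
    have xy: "(x, y) \<in> R \<longleftrightarrow> (f (Suc x), f (Suc y)) \<in> adjoin_class S"
      using f(2)[of "Suc x" "Suc y"] by simp
    have neq: "(f 0, f (Suc x)) \<notin> adjoin_class S" "(f (Suc x), f 0) \<notin> adjoin_class S" for x
      using f(2)[of 0 "Suc x"] f(2)[of "Suc x" 0] by simp_all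
    show ?thesis
      using neq[of x] neq[of y] unfolding xy g_def adjoin_class_iff
      by (auto simp: refl split: if_splits)
  qed
  ultimately show ?thesis
    unfolding pr_reducible_def by blast
qed

text \<open>
  The class of \<open>0\<close> in \<open>S\<close> plays the role of the adjoined class. It is removed from \<open>S\<close> by merging it
  with the class of some \<open>a\<close> outside, because the domain of the remaining relation has to be
  all of the natural numbers. The map \<open>f\<close> retracts onto the complement of the class of \<open>0\<close>, and the
  remaining relation is the preimage of \<open>S\<close> under \<open>f\<close>.
\<close>

lemma adjoin_class_surj:
  assumes S: "punctual_equiv S"
  obtains R where "punctual_equiv R" "adjoin_class R \<equiv>\<^sub>p\<^sub>r S"
proof -
  have eq: "equiv UNIV S" and prS: "primitive_rec_rel S" and inf: "infinite (UNIV // S)"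
    using S by (auto simp: punctual_equiv_def)
  have refl: "(x, x) \<in> S" and sym: "(x, y) \<in> S \<longleftrightarrow> (y, x) \<in> S"
    and trans: "(x, y) \<in> S \<Longrightarrow> (y, z) \<in> S \<Longrightarrow> (x, z) \<in> S" for x y z
    using eq unfolding equiv_UNIV_iff by blast+
  have "\<exists>a. (a, 0) \<notin> S"
  proof (rule ccontr)
    assume "\<not> ?thesis"
    then have "(x, y) \<in> S" for x y
      using sym trans by blast
    then have "UNIV // S \<subseteq> {UNIV}"
      by (auto simp: quotient_def)
    then show False
      using inf finite_subset by blast
  qed
  then obtain a where a: "(a, 0) \<notin> S" ..
  define f where "f x = (if (x, 0) \<in> S then a else x)" for x
  define R where "R = {(x, y). (f x, f y) \<in> S}"
  have f0: "(f x, 0) \<notin> S" "(0, f x) \<notin> S" for x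
    using a by (auto simp: f_def sym)
  have pr_f: "pr n (\<lambda>xs. f (h xs))" if "pr n h" for n h
    unfolding f_def by (intro pr_if_rel prS pr_intros that)
  have "equiv UNIV R"
    using eq unfolding equiv_UNIV_iff R_def by blast
  moreover have "primitive_rec_rel R"
    unfolding primitive_rec_rel_iff_pr R_def mem_Collect_eq prod.case
    by (intro pr_if_rel prS pr_intros pr_f) auto
  moreover have "adjoin_class R \<le>\<^sub>p\<^sub>r S"
  proof -
    have "pr 1 (\<lambda>xs. if xs ! 0 = 0 then 0 else f (xs ! 0 - 1))"
      by (intro pr_intros pr_f) auto
    then have "primitive_rec_fun (\<lambda>x. if x = 0 then 0 else f (x - 1))"
      by (simp add: primitive_rec_fun_iff_pr)
    then show ?thesis
      by (rule pr_reducibleI) (simp add: adjoin_class_iff R_def f0 refl)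
  qed
  moreover define g where "g x = (if (x, 0) \<in> S then 0 else Suc x)" for x
  have g: "(x, y) \<in> S \<longleftrightarrow> (g x, g y) \<in> adjoin_class R" for x y
  proof -
    have "(x, y) \<in> S \<Longrightarrow> (x, 0) \<in> S \<longleftrightarrow> (y, 0) \<in> S" and "(x, 0) \<in> S \<Longrightarrow> (y, 0) \<in> S \<Longrightarrow> (x, y) \<in> S"
      using sym trans by blast+
    then show ?thesis
      by (auto simp: adjoin_class_iff R_def g_def f_def)
  qed
  moreover have "S \<le>\<^sub>p\<^sub>r adjoin_class R"
  proof -
    have "pr 1 (\<lambda>xs. g (xs ! 0))"
      unfolding g_def by (intro pr_if_rel prS pr_intros) auto
    then show ?thesis
      unfolding pr_reducible_def primitive_rec_fun_iff_pr using g by blast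
  qed
  moreover have "infinite (UNIV // R)"
  proof
    assume fin: "finite (UNIV // R)"
    have "UNIV // adjoin_class R \<subseteq> insert {0} (image Suc ` (UNIV // R))"
    proof
      fix C
      assume "C \<in> UNIV // adjoin_class R"
      then obtain x where x: "C = adjoin_class R `` {x}"
        by (auto elim: quotientE)
      show "C \<in> insert {0} (image Suc ` (UNIV // R))"
      proof (cases x)
        case 0
        then show ?thesis
          using x by (auto simp: adjoin_class_def)
      next
        case (Suc z)
        then have "C = Suc ` (R `` {z})"
          using x by (auto simp: adjoin_class_def)
        then show ?thesis
          by (auto intro: quotientI)
      qed
    qed
    then have "finite (UNIV // adjoin_class R)"
      using fin by (meson finite.insertI finite_imageI finite_subset)
    then show False
      using infinite_quotient_transfer[OF eq equiv_adjoin_class g inf] \<open>equiv UNIV R\<close> by blast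
  qed
  ultimately show thesis
    using that[of R] by (auto simp: punctual_equiv_def pr_equivalent_def)
qed

text \<open>
  Defined on a degree as a set of relations: adjoin a class to each member and close under
  equivalence. No representative has to be chosen.
\<close>

definition adjoin_class_degree :: "nat rel set \<Rightarrow> nat rel set" where
  "adjoin_class_degree C = punctual_equivalence `` (adjoin_class ` C)"

abbreviation punctual_degree :: "nat rel \<Rightarrow> nat rel set" where
  "punctual_degree R \<equiv> punctual_equivalence `` {R}"

lemma adjoin_class_degree_eq:
  assumes "punctual_equiv R"
  shows "adjoin_class_degree (punctual_degree R) = punctual_degree (adjoin_class R)"
proof -
  have "(adjoin_class R, adjoin_class R') \<in> punctual_equivalence"
    if "(R, R') \<in> punctual_equivalence" for R'
    using that by (auto simp: punctual_equivalence_def pr_equivalent_def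
      intro: punctual_equiv_adjoin_class adjoin_class_mono)
  moreover have "(R, R) \<in> punctual_equivalence"
    using assms by (simp add: punctual_equivalence_def pr_equivalent_def pr_reducible_refl)
  ultimately show ?thesis
    unfolding adjoin_class_degree_def
    by (auto, meson equiv_punctual_equivalence equivE transD)
qed

lemma punctual_degree_eq_iff:
  assumes "punctual_equiv R" "punctual_equiv S"
  shows "punctual_degree R = punctual_degree S \<longleftrightarrow> R \<equiv>\<^sub>p\<^sub>r S"
  using eq_equiv_class_iff[OF equiv_punctual_equivalence] assms
  by (auto simp: punctual_equivalence_def)

lemma Peq_cases:
  assumes "a \<in> Peq"
  obtains R where "punctual_equiv R" "a = punctual_degree R"
  using assms by (auto simp: Peq_def elim: quotientE)

lemma punctual_degree_in_Peq: "punctual_equiv R \<Longrightarrow> punctual_degree R \<in> Peq"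
  by (auto simp: Peq_def intro: quotientI)

lemma adjoin_class_le_iff:
  assumes "punctual_equiv S"
  shows "adjoin_class R \<le>\<^sub>p\<^sub>r adjoin_class S \<longleftrightarrow> R \<le>\<^sub>p\<^sub>r S"
  using assms adjoin_class_mono adjoin_class_cancel by (auto simp: punctual_equiv_def)

lemma order_automorphism_adjoin_class_degree:
  "order_automorphism Peq Peq_order adjoin_class_degree"
  unfolding order_automorphism_def bij_betw_def
proof (intro conjI ballI)
  show "inj_on adjoin_class_degree Peq"
  proof (rule inj_onI)
    fix a b
    assume eq: "adjoin_class_degree a = adjoin_class_degree b" and "a \<in> Peq" "b \<in> Peq"
    then obtain R S where R: "punctual_equiv R" "a = punctual_degree R"
      and S: "punctual_equiv S" "b = punctual_degree S"
      by (meson Peq_cases)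
    then have "adjoin_class R \<equiv>\<^sub>p\<^sub>r adjoin_class S"
      using eq by (simp add: adjoin_class_degree_eq punctual_degree_eq_iff punctual_equiv_adjoin_class)
    then show "a = b"
      using R S by (simp add: punctual_degree_eq_iff pr_equivalent_def adjoin_class_le_iff)
  qed
  show "adjoin_class_degree ` Peq = Peq"
  proof (intro equalityI subsetI)
    fix a
    assume "a \<in> adjoin_class_degree ` Peq"
    then show "a \<in> Peq"
      by (auto elim!: Peq_cases
          simp: adjoin_class_degree_eq punctual_equiv_adjoin_class punctual_degree_in_Peq)
  next
    fix a
    assume "a \<in> Peq"
    then obtain S where S: "punctual_equiv S" "a = punctual_degree S"
      by (rule Peq_cases)
    obtain R where R: "punctual_equiv R" "adjoin_class R \<equiv>\<^sub>p\<^sub>r S"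
      using adjoin_class_surj[OF S(1)] .
    then have "a = adjoin_class_degree (punctual_degree R)"
      using S punctual_degree_eq_iff[of "adjoin_class R" S]
      by (simp add: adjoin_class_degree_eq punctual_equiv_adjoin_class)
    then show "a \<in> adjoin_class_degree ` Peq"
      using R(1) punctual_degree_in_Peq by blast
  qed
next
  fix a b
  assume "a \<in> Peq" "b \<in> Peq"
  then show "(a, b) \<in> Peq_order \<longleftrightarrow> (adjoin_class_degree a, adjoin_class_degree b) \<in> Peq_order"
    by (auto elim!: Peq_cases simp: adjoin_class_degree_eq punctual_equiv_adjoin_class
        Peq_order_class_iff adjoin_class_le_iff)
qed


section \<open>A fast-growing hierarchy bounding all primitive recursive functions\<close>

text \<open>
  The number of iterations, \<open>n + 2\<close>, is at least two for every \<open>n\<close>; so one level absorbs the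
  composition of two functions from the level below, uniformly in the argument
  (\<open>hierarchy_twice_le\<close>). The start value \<open>n + 1\<close> accounts for the one step by which the
  stack machine below replaces its top entry.
\<close>

fun hierarchy :: "nat \<Rightarrow> nat \<Rightarrow> nat" where
  "hierarchy 0 n = Suc n"
| "hierarchy (Suc a) n = (hierarchy a ^^ Suc (Suc n)) (Suc n)"

lemma funpow_inflationary:
  fixes f :: "nat \<Rightarrow> nat"
  assumes "\<And>x. x < f x"
  shows "x + k \<le> (f ^^ k) x"
proof (induction k)
  case (Suc k)
  then show ?case
    using assms[of "(f ^^ k) x"] by simp
qed simp

lemma hierarchy_gt: "n < hierarchy a n"
proof (induction a arbitrary: n)
  case (Suc a)
  show ?case
    using funpow_inflationary[of "hierarchy a" "Suc n" "Suc (Suc n)", OF Suc.IH]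
    unfolding hierarchy.simps by linarith
qed simp

lemma hierarchy_mono: "m \<le> n \<Longrightarrow> hierarchy a m \<le> hierarchy a n"
proof (induction a arbitrary: m n)
  case (Suc a)
  then have mono: "mono (hierarchy a)"
    by (auto intro: monoI)
  have "(hierarchy a ^^ Suc (Suc m)) (Suc m) \<le> (hierarchy a ^^ Suc (Suc m)) (Suc n)"
    by (rule funpow_mono[OF mono]) (use Suc.prems in simp)
  also have "\<dots> \<le> (hierarchy a ^^ Suc (Suc n)) (Suc n)"
    by (rule funpow_mono2[OF mono]) (use Suc.prems hierarchy_gt in \<open>auto intro: less_imp_le\<close>)
  finally show ?case
    by simp
qed simp

lemma hierarchy_funpow_mono: "j \<le> k \<Longrightarrow> m \<le> n \<Longrightarrow> (hierarchy a ^^ j) m \<le> (hierarchy a ^^ k) n"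
  by (rule funpow_mono2) (auto intro: monoI hierarchy_mono less_imp_le hierarchy_gt)

lemma hierarchy_twice_le: "hierarchy a (hierarchy a n) \<le> hierarchy (Suc a) n"
  using hierarchy_funpow_mono[of 2 "Suc (Suc n)" n "Suc n" a] by (simp add: numeral_2_eq_2)

lemma hierarchy_strict_mono_level: "a < b \<Longrightarrow> hierarchy a n < hierarchy b n"
proof (rule lift_Suc_mono_less[of "\<lambda>a. hierarchy a n"])
  show "hierarchy a n < hierarchy (Suc a) n" for a
    using hierarchy_twice_le[of a n] hierarchy_gt[of "hierarchy a n" a] by simp
qed

lemma hierarchy_mono2: "a \<le> b \<Longrightarrow> m \<le> n \<Longrightarrow> hierarchy a m \<le> hierarchy b n"
  by (metis hierarchy_mono hierarchy_strict_mono_level le_trans less_imp_le order_le_less)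

text \<open>
  The bound is in terms of any common bound \<open>m\<close> of the arguments rather than their maximum, which
  spares the case of the empty argument list.
\<close>

definition hierarchy_bounded :: "nat \<Rightarrow> nat \<Rightarrow> (nat list \<Rightarrow> nat) \<Rightarrow> bool" where
  "hierarchy_bounded a n F \<longleftrightarrow>
    (\<forall>xs m. length xs = n \<longrightarrow> (\<forall>x\<in>set xs. x \<le> m) \<longrightarrow> F xs \<le> hierarchy a m)"

lemma hierarchy_bounded_level_mono:
  "hierarchy_bounded a n F \<Longrightarrow> a \<le> b \<Longrightarrow> hierarchy_bounded b n F"
  unfolding hierarchy_bounded_def using hierarchy_mono2[of a b] le_trans by blast

text \<open>
  A composition of functions bounded by level \<open>c\<close> is bounded by twice applying level \<open>c\<close>. A recursion
  of length \<open>k \<le> m\<close> applies level \<open>c\<close> at most \<open>m + 1\<close> times, once for the start value and once for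
  each step. Both are bounded by level \<open>c + 1\<close>.
\<close>

lemma primitive_rec_hierarchy_bounded: "primitive_rec n F \<Longrightarrow> \<exists>a. hierarchy_bounded a n F"
proof (induction rule: primitive_rec.induct)
  case (zero n)
  show ?case
    by (auto simp: hierarchy_bounded_def)
next
  case succ
  have "hierarchy_bounded 0 1 (\<lambda>xs. Suc (hd xs))"
    by (auto simp: hierarchy_bounded_def length_Suc_conv)
  then show ?case ..
next
  case (proj i n)
  have "hierarchy_bounded 0 n (\<lambda>xs. xs ! i)"
    using proj by (auto simp: hierarchy_bounded_def intro: le_SucI)
  then show ?case ..
next
  case (comp Gs F n)
  obtain a where a: "hierarchy_bounded a (length Gs) F"
    using comp.IH(1) by blast
  obtain B where B: "\<And>G. G \<in> set Gs \<Longrightarrow> hierarchy_bounded (B G) n G"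
    using comp.IH(2) by metis
  define c where "c = a + sum_list (map B Gs)"
  have "B G \<le> c" if "G \<in> set Gs" for G
    unfolding c_def using that by (intro trans_le_add2 member_le_sum_list) auto
  then have c: "hierarchy_bounded c (length Gs) F" "\<And>G. G \<in> set Gs \<Longrightarrow> hierarchy_bounded c n G"
    using a B by (auto intro: hierarchy_bounded_level_mono simp: c_def)
  have "F (map (\<lambda>G. G xs) Gs) \<le> hierarchy (Suc c) m"
    if "length xs = n" "\<forall>x\<in>set xs. x \<le> m" for xs m
  proof -
    have "\<forall>y\<in>set (map (\<lambda>G. G xs) Gs). y \<le> hierarchy c m"
      using c(2) that by (auto simp: hierarchy_bounded_def)
    then have "F (map (\<lambda>G. G xs) Gs) \<le> hierarchy c (hierarchy c m)"
      using c(1) unfolding hierarchy_bounded_def by (metis length_map)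
    then show ?thesis
      using hierarchy_twice_le le_trans by blast
  qed
  then show ?case
    unfolding hierarchy_bounded_def by blast
next
  case (prec n F G)
  obtain a b where "hierarchy_bounded a n F" "hierarchy_bounded b (Suc (Suc n)) G"
    using prec.IH by blast
  then have c: "hierarchy_bounded (a + b) n F" "hierarchy_bounded (a + b) (Suc (Suc n)) G"
    by (auto intro: hierarchy_bounded_level_mono)
  define c where "c = a + b"
  have "rec_nat (F (tl xs)) (\<lambda>k r. G (k # r # tl xs)) (hd xs) \<le> hierarchy (Suc c) m"
    if len: "length xs = Suc n" and m: "\<forall>x\<in>set xs. x \<le> m" for xs m
  proof -
    let ?r = "rec_nat (F (tl xs)) (\<lambda>k r. G (k # r # tl xs))"
    have hd: "hd xs \<le> m" and tl: "\<forall>x\<in>set (tl xs). x \<le> m" "length (tl xs) = n"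
      using len m by (cases xs; auto)+
    \<comment> \<open>The bound for the value after \<open>k\<close> steps also bounds \<open>k\<close> and the parameters.\<close>
    have "?r k \<le> (hierarchy c ^^ Suc k) m" if "k \<le> m" for k
      using that
    proof (induction k)
      case 0
      show ?case
        using c(1) tl by (simp add: hierarchy_bounded_def c_def)
    next
      case (Suc k)
      let ?M = "(hierarchy c ^^ Suc k) m"
      have "m \<le> ?M"
        using hierarchy_funpow_mono[of 0 "Suc k" m m c] by simp
      then have "\<forall>x\<in>set (k # ?r k # tl xs). x \<le> ?M"
        using Suc tl by auto
      then have "G (k # ?r k # tl xs) \<le> hierarchy c ?M"
        using c(2) tl unfolding hierarchy_bounded_def c_def by (metis length_Cons)
      then show ?case
        by simp
    qed
    from this[OF hd] have "?r (hd xs) \<le> (hierarchy c ^^ Suc (hd xs)) m" .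
    also have "\<dots> \<le> (hierarchy c ^^ Suc (Suc m)) (Suc m)"
      using hd by (intro hierarchy_funpow_mono) auto
    finally show ?thesis
      by simp
  qed
  then show ?case
    unfolding hierarchy_bounded_def by blast
qed

lemma primitive_rec_fun_bounded:
  assumes "primitive_rec_fun f"
  shows "\<exists>a. \<forall>x. f x \<le> hierarchy a x"
proof -
  obtain F where F: "primitive_rec 1 F" "\<And>x. F [x] = f x"
    using assms unfolding primitive_rec_fun_def by blast
  obtain a where "hierarchy_bounded a 1 F"
    using primitive_rec_hierarchy_bounded[OF F(1)] by blast
  then have "F [x] \<le> hierarchy a x" for x
    by (simp add: hierarchy_bounded_def)
  then show ?thesis
    using F(2) by auto
qed


section \<open>A stack machine with running times from the hierarchy\<close>

text \<open>
  At time \<open>t\<close> a top entry \<open>0\<close> is removed and a top entry \<open>a + 1\<close> is replaced with \<open>t + 2\<close> copies of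
  \<open>a\<close>, matching the \<open>t + 2\<close> iterations in the definition of \<open>hierarchy\<close>. Time and argument of
  the hierarchy coincide, so the machine needs no other register. An empty stack is refilled
  with the current time.
\<close>

fun next_stack :: "nat \<Rightarrow> nat list \<Rightarrow> nat list" where
  "next_stack t [] = [t]"
| "next_stack t (0 # as) = as"
| "next_stack t (Suc a # as) = replicate (Suc (Suc t)) a @ as"

primrec stack :: "nat \<Rightarrow> nat list" where
  "stack 0 = []"
| "stack (Suc t) = next_stack t (stack t)"

text \<open>
  By induction on the entry \<open>a\<close> that is on top at time \<open>n\<close>: if \<open>a > 0\<close>, then it is replaced at time
  \<open>n + 1\<close> with \<open>n + 2\<close> copies of \<open>a - 1\<close>, which are worked off one after another, and each of them
  advances the time from \<open>t\<close> to \<open>hierarchy (a - 1) t\<close>.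
\<close>

lemma stack_run:
  assumes "stack n = a # as"
  shows "stack (hierarchy a n) = as \<and> (\<forall>t. n \<le> t \<longrightarrow> t < hierarchy a n \<longrightarrow> stack t \<noteq> [])"
  using assms
proof (induction a arbitrary: n as)
  case 0
  then show ?case
    by (auto simp: less_Suc_eq_le dest: le_antisym)
next
  case (Suc a)
  have run: "stack ((hierarchy a ^^ j) n) = as \<and>
      (\<forall>t. n \<le> t \<longrightarrow> t < (hierarchy a ^^ j) n \<longrightarrow> stack t \<noteq> [])"
    if "stack n = replicate j a @ as" for j n
    using that
  proof (induction j arbitrary: n)
    case (Suc j)
    have 1: "stack (hierarchy a n) = replicate j a @ as"
        "\<forall>t. n \<le> t \<longrightarrow> t < hierarchy a n \<longrightarrow> stack t \<noteq> []"
      using \<open>\<And>n as. stack n = a # as \<Longrightarrow> _\<close>[of n "replicate j a @ as"] Suc.prems by auto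
    then show ?case
      using Suc.IH[OF 1(1)] unfolding funpow_Suc_right o_def by (meson not_le)
  qed auto
  have "stack (Suc n) = replicate (Suc (Suc n)) a @ as"
    using Suc.prems by simp
  from run[OF this] Suc.prems show ?case
    unfolding hierarchy.simps by (metis Suc_leI le_neq_implies_less list.distinct(1))
qed

lemma stack_restart:
  assumes "stack N = []"
  shows "stack (hierarchy N (Suc N)) = []"
    and "N < t \<Longrightarrow> t < hierarchy N (Suc N) \<Longrightarrow> stack t \<noteq> []"
  using stack_run[of "Suc N" N "[]"] assms by auto

lemma stack_empty_unbounded: "\<exists>N\<ge>b. stack N = []"
proof (induction b)
  case 0
  show ?case
    by (rule exI[of _ 0]) simp
next
  case (Suc b)
  then obtain N where "N \<ge> b" "stack N = []"
    by blast
  then show ?case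
    using stack_restart(1)[of N] hierarchy_gt[of "Suc N" N]
    by (intro exI[of _ "hierarchy N (Suc N)"]) auto
qed

text \<open>
  The binary expansion of the code is a sequence of blocks, the lowest one being a digit \<open>1\<close>
  followed, towards the lower end, by as many zeros as the top entry says. With this code, halving
  removes a top entry \<open>0\<close> and decreases a positive top entry by one.
\<close>

fun encode :: "nat list \<Rightarrow> nat" where
  "encode [] = 0"
| "encode (a # as) = 2 ^ a * (2 * encode as + 1)"

lemma encode_eq_0_iff: "encode as = 0 \<longleftrightarrow> as = []"
  by (cases as) auto

text \<open>
  The largest power of two dividing \<open>s > 0\<close>, found by doubling \<open>s\<close> times, as long as the result
  divides \<open>s\<close>. It gives \<open>2 ^ a\<close> for the top entry \<open>a\<close>.
\<close>

definition low_bit :: "nat \<Rightarrow> nat" where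
  "low_bit s = rec_nat 1 (\<lambda>_ d. if s mod (2 * d) = 0 then 2 * d else d) s"

lemma low_bit_eq: "low_bit (2 ^ a * (2 * b + 1)) = 2 ^ a"
proof -
  let ?s = "2 ^ a * (2 * b + 1)"
  have "rec_nat 1 (\<lambda>_ d. if ?s mod (2 * d) = 0 then 2 * d else d) i = 2 ^ min i a" for i
  proof (induction i)
    case (Suc i)
    have "?s mod (2 * 2 ^ min i a) = 0 \<longleftrightarrow> i < a"
    proof (cases "i < a")
      case True
      then have "2 ^ Suc i dvd ?s"
        by (intro dvd_mult2 le_imp_power_dvd) simp
      then show ?thesis
        using True by (simp add: min_def)
    next
      case False
      then have "?s mod (2 * 2 ^ min i a) = 2 ^ a * ((2 * b + 1) mod 2)"
        by (metis min.absorb2 mult.commute mult_mod_right not_less)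
      then show ?thesis
        using False by simp
    qed
    then show ?case
      using Suc by (auto simp: min_def le_Suc_eq)
  qed simp
  moreover have "a \<le> ?s"
    by (metis add.commute le_trans less_exp less_imp_le mult.right_neutral mult_le_mono2 le_add1)
  ultimately show ?thesis
    unfolding low_bit_def by simp
qed

definition push_copies :: "nat \<Rightarrow> nat \<Rightarrow> nat \<Rightarrow> nat" where
  "push_copies j d s = rec_nat s (\<lambda>_ r. d * (2 * r + 1)) j"

lemma push_copies_encode: "push_copies j (2 ^ a) (encode as) = encode (replicate j a @ as)"
  by (induction j) (auto simp: push_copies_def)

text \<open>
  For a positive top entry \<open>a + 1\<close>, halving already yields one copy of \<open>a\<close>; hence only \<open>t + 1\<close>
  further copies are pushed.
\<close>

definition next_code :: "nat \<Rightarrow> nat \<Rightarrow> nat" where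
  "next_code t s = (if s = 0 then 2 ^ t else if s mod 2 = 1 then s div 2
    else push_copies (Suc t) (low_bit (s div 2)) (s div 2))"

lemma next_code_encode: "next_code t (encode as) = encode (next_stack t as)"
proof (cases "(t, as)" rule: next_stack.cases)
  case (3 t' a bs)
  then have as: "as = Suc a # bs"
    by simp
  have half: "encode as div 2 = encode (a # bs)"
    using as by simp
  have "encode as \<noteq> 0" "encode as mod 2 \<noteq> 1"
    using as by auto
  then have "next_code t (encode as) = push_copies (Suc t) (2 ^ a) (encode (a # bs))"
    unfolding next_code_def half using low_bit_eq[of a "encode bs"] by simp
  also have "\<dots> = encode (replicate (Suc t) a @ a # bs)"
    by (rule push_copies_encode)
  also have "replicate (Suc t) a @ a # bs = next_stack t as"
    unfolding as by (simp add: replicate_app_Cons_same)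
  finally show ?thesis .
qed (auto simp: next_code_def)

lemma pr_encode_stack:
  assumes "pr n f"
  shows "pr n (\<lambda>xs. encode (stack (f xs)))"
proof -
  have low: "pr m (\<lambda>xs. low_bit (h xs))" if "pr m h" for m h
    unfolding low_bit_def
    by (rule pr_rec2[where g = "\<lambda>_ d s. if s mod (2 * d) = 0 then 2 * d else d" and a = "\<lambda>_. 1"])
      (intro pr_intros that; simp)+
  have push: "pr m (\<lambda>xs. push_copies (h1 xs) (h2 xs) (h3 xs))"
    if "pr m h1" "pr m h2" "pr m h3" for m h1 h2 h3
    unfolding push_copies_def
    by (rule pr_rec3[where g = "\<lambda>_ r d s. d * (2 * r + 1)" and a = "\<lambda>d s. s"])
      (intro pr_intros that; simp)+
  have "pr n (\<lambda>xs. rec_nat 0 next_code (f xs))"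
    by (rule pr_rec1[OF _ assms]) (unfold next_code_def, intro pr_intros low push; simp)
  moreover have "rec_nat 0 next_code t = encode (stack t)" for t
    by (induction t) (auto simp: next_code_encode)
  ultimately show ?thesis
    by simp
qed


section \<open>An equivalence relation that changes when a class is adjoined\<close>

text \<open>
  The time \<open>0\<close> is not counted although the stack is empty then, so the classes of \<open>sparse_rel\<close>
  are numbered from \<open>0\<close>. Each class is an interval that begins at a time of the empty stack.
\<close>

primrec halt_count :: "nat \<Rightarrow> nat" where
  "halt_count 0 = 0"
| "halt_count (Suc t) = halt_count t + (if stack (Suc t) = [] then 1 else 0)"

definition sparse_rel :: "nat rel" where
  "sparse_rel = {(x, y). halt_count x = halt_count y}"

lemma halt_count_mono: "x \<le> y \<Longrightarrow> halt_count x \<le> halt_count y"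
  by (rule lift_Suc_mono_le[of halt_count]) auto

lemma halt_count_before_next_halt:
  assumes "stack N = []" "N \<le> t" "t < hierarchy N (Suc N)"
  shows "halt_count t = halt_count N"
  using assms(2,3)
proof (induction t rule: dec_induct)
  case (step t)
  then show ?case
    using stack_restart(2)[OF assms(1), of "Suc t"] by simp
qed simp

lemma halt_count_attained: "\<exists>x. halt_count x = k"
proof (induction k)
  case 0
  show ?case
    by (rule exI[of _ 0]) simp
next
  case (Suc k)
  then obtain x where x: "halt_count x = k"
    by blast
  obtain N where N: "N \<ge> Suc x" "stack N = []"
    using stack_empty_unbounded by blast
  then obtain M where M: "N = Suc M"
    by (cases N) auto
  have "halt_count x \<le> halt_count M"
    using N M by (intro halt_count_mono) auto
  then have ge: "halt_count N \<ge> Suc k"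
    using x N M by simp
  define L where "L = (LEAST y. halt_count y \<ge> Suc k)"
  have L: "halt_count L \<ge> Suc k" "\<And>y. y < L \<Longrightarrow> \<not> halt_count y \<ge> Suc k"
    unfolding L_def using LeastI[of "\<lambda>y. halt_count y \<ge> Suc k", OF ge] not_less_Least by blast+
  then obtain L' where "L = Suc L'"
    by (cases L) auto
  then have "halt_count L = Suc k"
    using L(1) L(2)[of L'] by (auto split: if_splits)
  then show ?case ..
qed

lemma punctual_equiv_sparse_rel: "punctual_equiv sparse_rel"
proof -
  have eq: "equiv UNIV sparse_rel"
    by (auto simp: sparse_rel_def intro!: equivI refl_onI symI transI)
  have count: "pr n (\<lambda>xs. halt_count (f xs))" if "pr n f" for n f
  proof -
    have "rec_nat 0 (\<lambda>t r. r + (if encode (stack (Suc t)) = 0 then 1 else 0)) x = halt_count x" for x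
      by (induction x) (auto simp: encode_eq_0_iff)
    moreover have "pr n (\<lambda>xs. rec_nat 0 (\<lambda>t r. r + (if encode (stack (Suc t)) = 0 then 1 else 0)) (f xs))"
      by (rule pr_rec1[OF _ that]) (intro pr_intros pr_encode_stack; simp)
    ultimately show ?thesis
      by simp
  qed
  have "primitive_rec_rel sparse_rel"
    unfolding primitive_rec_rel_iff_pr sparse_rel_def mem_Collect_eq prod.case
    by (intro pr_intros count) auto
  moreover obtain g where g: "\<And>k. halt_count (g k) = k"
    using halt_count_attained by metis
  have "infinite (UNIV // (Id :: nat rel))"
    by (simp add: quotient_def UNION_singleton_eq_range finite_image_iff)
  then have "infinite (UNIV // sparse_rel)"
    using eq by (intro infinite_quotient_transfer[of Id sparse_rel g])
      (auto simp: g sparse_rel_def intro: equivI refl_Id sym_Id trans_Id)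
  ultimately show ?thesis
    using eq by (simp add: punctual_equiv_def)
qed

text \<open>
  Let level \<open>a\<close> of the hierarchy bound a reduction \<open>f\<close>, and let the stack be empty at time \<open>N > a\<close>.
  The next time of the empty stack, \<open>hierarchy N (N + 1)\<close>, exceeds all \<open>f x\<close> with \<open>x \<le> N + 1\<close>, so
  these values lie in the first \<open>k + 1\<close> classes if \<open>N\<close> begins the class with number \<open>k\<close>. But
  with the adjoined class, the numbers up to \<open>N + 1\<close> meet \<open>k + 2\<close> classes.
\<close>

lemma not_adjoin_class_sparse_rel_le: "\<not> adjoin_class sparse_rel \<le>\<^sub>p\<^sub>r sparse_rel"
proof
  assume "adjoin_class sparse_rel \<le>\<^sub>p\<^sub>r sparse_rel"
  then obtain f where pr: "primitive_rec_fun f"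
    and f: "\<And>x y. (x, y) \<in> adjoin_class sparse_rel \<longleftrightarrow> (f x, f y) \<in> sparse_rel"
    unfolding pr_reducible_def by blast
  obtain a where a: "\<And>x. f x \<le> hierarchy a x"
    using primitive_rec_fun_bounded[OF pr] by blast
  obtain N where N: "N \<ge> Suc a" "stack N = []"
    using stack_empty_unbounded by blast
  define k where "k = halt_count N"
  have bound: "halt_count (f x) \<le> k" if "x \<le> Suc N" for x
  proof -
    have "f x \<le> hierarchy a (Suc N)"
      using a[of x] hierarchy_mono[OF that] le_trans by blast
    also have "\<dots> < hierarchy N (Suc N)"
      using N by (intro hierarchy_strict_mono_level) simp
    finally have fx: "f x < hierarchy N (Suc N)" .
    have "halt_count (max N (f x)) = k"
      unfolding k_def using N fx hierarchy_gt[of "Suc N" N]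
      by (intro halt_count_before_next_halt) auto
    then show ?thesis
      using halt_count_mono[of "f x" "max N (f x)"] by simp
  qed
  obtain g where g: "\<And>j. halt_count (g j) = j"
    using halt_count_attained by metis
  \<comment> \<open>Representatives, at most \<open>N + 1\<close>, of the first \<open>k + 2\<close> classes. For the last one \<open>g k\<close> could be
    too large, so \<open>N\<close> is taken.\<close>
  define h where "h j = (case j of 0 \<Rightarrow> 0 | Suc i \<Rightarrow> Suc (if i = k then N else g i))" for j
  have g_le: "g i \<le> N" if "i < k" for i
    using halt_count_mono[of N "g i"] that g[of i] unfolding k_def by linarith
  have "inj_on (\<lambda>j. halt_count (f (h j))) {..Suc k}"
  proof (rule inj_onI)
    fix i j
    assume "halt_count (f (h i)) = halt_count (f (h j))"
    then have "(h i, h j) \<in> adjoin_class sparse_rel"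
      by (simp add: f) (simp add: sparse_rel_def)
    then show "i = j"
      by (cases i; cases j) (auto simp: h_def sparse_rel_def g k_def split: if_splits)
  qed
  moreover have "(\<lambda>j. halt_count (f (h j))) ` {..Suc k} \<subseteq> {..k}"
  proof (intro image_subsetI)
    fix j
    assume "j \<in> {..Suc k}"
    then have "h j \<le> Suc N"
      using g_le by (auto simp: h_def split: nat.split)
    then show "halt_count (f (h j)) \<in> {..k}"
      using bound by simp
  qed
  ultimately have "card {..Suc k} \<le> card {..k}"
    by (rule card_inj_on_le) simp
  then show False
    by simp
qed

theorem theorem9p10:
  shows "\<not> rigid_order Peq Peq_order"
proof
  assume "rigid_order Peq Peq_order"
  then have "adjoin_class_degree (punctual_degree sparse_rel) = punctual_degree sparse_rel"
    using order_automorphism_adjoin_class_degree punctual_equiv_sparse_rel punctual_degree_in_Peq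
    unfolding rigid_order_def by blast
  then have "adjoin_class sparse_rel \<equiv>\<^sub>p\<^sub>r sparse_rel"
    using punctual_equiv_sparse_rel
    by (simp add: adjoin_class_degree_eq punctual_degree_eq_iff punctual_equiv_adjoin_class)
  then show False
    using not_adjoin_class_sparse_rel_le by (simp add: pr_equivalent_def)
qed

end
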